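(* Let $n\ge 1$ and let $G$ be a finitely generated abelian sub-semigroup of $M_n(\mathbb{C})$, generated by $A_1,\dots,A_p$ ($p\ge 1$). Let $P\in \mathrm{GL}(n,\mathbb{C})$, $r\in\{1,\dots,n\}$ and $\eta=(n_1,\dots,n_r)$ be a sequence of positive integers with $n_1+\dots+n_r=n$ such that $P^{-1}GP\subset \mathcal{K}_{\eta,r}(\mathbb{C})$, and let $v_0=Pu_0$, where $u_0=[e_{1,1},\dots,e_{r,1}]^T\in\mathbb{C}^n$ and $e_{k,1}=[1,0,\dots,0]^T\in\mathbb{C}^{n_k}$ for $k=1,\dots,r$. Then the following are equivalent: (i) $G$ is hypercyclic; (ii) $J_G(v_0)=\mathbb{C}^n$; (iii) $\overline{G(v_0)}=\mathbb{C}^n$.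
   Context: $M_n(\mathbb{C})$ is the set of $n\times n$ complex matrices. $\mathbb{N}$ contains $0$. The abelian semigroup $G$ generated by pairwise commuting matrices $A_1,\dots,A_p$ is the set of products $A_1^{k_1}\cdots A_p^{k_p}$ with $k_j$ non-negative integers. The orbit of $v\in\mathbb{C}^n$ is $G(v)=\{Av: A\in G\}$, and $\overline{E}$ is the closure of $E\subset\mathbb{C}^n$. $G$ is hypercyclic if there exists $v\in\mathbb{C}^n$ with $\overline{G(v)}=\mathbb{C}^n$. Extended limit set: for $x\in\mathbb{C}^n$, $J_G(x)$ is the set of $y\in\mathbb{C}^n$ for which there exist a sequence $(x_m)_m\subset\mathbb{C}^n$ and sequences of non-negative integers $(k_m^{(j)})_m$, $j=1,\dots,p$, with $k_m^{(1)}+\dots+k_m^{(p)}\to+\infty$, such that $x_m\to x$ and $A_1^{k_m^{(1)}}\cdots A_p^{k_m^{(p)}}x_m\to y$. $\mathbb{T}_m(\mathbb{C})$ is the set of $m\times m$ complex lower triangular matrices whose diagonal entries are all equal. For positive integers $n_1,\dots,n_r$ with sum $n$ and $\eta=(n_1,\dots,n_r)$, $\mathcal{K}_{\eta,r}(\mathbb{C})=\mathbb{T}_{n_1}(\mathbb{C})\oplus\dots\oplus\mathbb{T}_{n_r}(\mathbb{C})$ is the set of block diagonal matrices $\mathrm{diag}(B_1,\dots,B_r)$ with $B_k\in\mathbb{T}_{n_k}(\mathbb{C})$. It is a known fact that for every abelian sub-semigroup $G$ of $M_n(\mathbb{C})$ there exist such $P,\eta,r$. $\mathbb{C}^n$ is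 identified with $\prod_k\mathbb{C}^{n_k}$. *)

theory Defs
  imports "HOL-Analysis.Analysis"
begin

text \<open>
  Square matrices of size \<open>n = CARD('n)\<close> are elements of \<open>complex ^ 'n ^ 'n\<close>; a linear order on the
  index type gives meaning to "lower triangular" and to consecutive diagonal blocks.
  The powers below are powers for the matrix product \<open>**\<close>; the class operations \<open>*\<close> and \<open>^\<close> on
  \<open>complex ^ 'n ^ 'n\<close> act componentwise and must not be used for this purpose.
\<close>

fun matpow :: "complex ^ 'n ^ 'n \<Rightarrow> nat \<Rightarrow> complex ^ 'n ^ 'n" where
  "matpow M 0 = mat 1"
| "matpow M (Suc k) = M ** matpow M k"

text \<open>The generators \<open>A\<^sub>1, \<dots>, A\<^sub>p\<close> are indexed from \<open>0\<close>: they are \<open>A 0, \<dots>, A (p - 1)\<close>.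
  The value of \<open>word A p k\<close> is \<open>(A 0)\<^bsup>k 0\<^esup> \<cdots> (A (p - 1))\<^bsup>k (p - 1)\<^esup>\<close>.\<close>

fun word :: "(nat \<Rightarrow> complex ^ 'n ^ 'n) \<Rightarrow> nat \<Rightarrow> (nat \<Rightarrow> nat) \<Rightarrow> complex ^ 'n ^ 'n" where
  "word A 0 k = mat 1"
| "word A (Suc p) k = word A p k ** matpow (A p) (k p)"

definition semigroup_gen :: "(nat \<Rightarrow> complex ^ 'n ^ 'n) \<Rightarrow> nat \<Rightarrow> (complex ^ 'n ^ 'n) set" where
  "semigroup_gen A p = {word A p k |k. True}"

definition orbit :: "(complex ^ 'n ^ 'n) set \<Rightarrow> complex ^ 'n \<Rightarrow> (complex ^ 'n) set" where
  "orbit G v = {M *v v |M. M \<in> G}"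

definition hypercyclic :: "(complex ^ 'n ^ 'n) set \<Rightarrow> bool" where
  "hypercyclic G \<longleftrightarrow> (\<exists>v. closure (orbit G v) = UNIV)"

text \<open>The extended limit set \<open>J\<^sub>G(x)\<close>; it depends on \<open>G\<close> through the chosen generators.\<close>

definition J_set ::
  "(nat \<Rightarrow> complex ^ 'n ^ 'n) \<Rightarrow> nat \<Rightarrow> complex ^ 'n \<Rightarrow> (complex ^ 'n) set" where
  "J_set A p x = {y. \<exists>(X :: nat \<Rightarrow> complex ^ 'n) (k :: nat \<Rightarrow> nat \<Rightarrow> nat).
      filterlim (\<lambda>m. \<Sum>j<p. k m j) at_top sequentially \<and>
      X \<longlonglongrightarrow> x \<and>
      (\<lambda>m. word A p (k m) *v X m) \<longlonglongrightarrow> y}"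

text \<open>The position of an index, counted from \<open>0\<close>, in the linear order of the index type.\<close>

definition pos :: "'n::{finite,linorder} \<Rightarrow> nat" where
  "pos i = card {j. j < i}"

text \<open>For \<open>\<eta> = [n\<^sub>1, \<dots>, n\<^sub>r]\<close>, the blocks are numbered \<open>0, \<dots>, r - 1\<close>; block \<open>k\<close> has size \<open>\<eta> ! k\<close> and
  starts at position \<open>block_start \<eta> k\<close>, the sum of the sizes of the earlier blocks.\<close>

definition block_start :: "nat list \<Rightarrow> nat \<Rightarrow> nat" where
  "block_start \<eta> k = sum_list (take k \<eta>)"

definition block :: "nat list \<Rightarrow> nat \<Rightarrow> 'n::{finite,linorder} set" where
  "block \<eta> k = {i. block_start \<eta> k \<le> pos i \<and> pos i < block_start \<eta> k + \<eta> ! k}"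

text \<open>The submatrix with rows and columns in \<open>S\<close> is lower triangular with equal diagonal entries.\<close>

definition T_on :: "'n::{finite,linorder} set \<Rightarrow> complex ^ ('n::{finite,linorder}) ^ ('n::{finite,linorder}) \<Rightarrow> bool" where
  "T_on S M \<longleftrightarrow> (\<forall>i\<in>S. \<forall>j\<in>S. i < j \<longrightarrow> M $ i $ j = 0) \<and> (\<forall>i\<in>S. \<forall>j\<in>S. M $ i $ i = M $ j $ j)"

definition K_set :: "nat list \<Rightarrow> (complex ^ ('n::{finite,linorder}) ^ ('n::{finite,linorder})) set" where
  "K_set \<eta> = {M. (\<forall>k<length \<eta>. T_on (block \<eta> k) M) \<and>
     (\<forall>k<length \<eta>. \<forall>l<length \<eta>. k \<noteq> l \<longrightarrow> (\<forall>i\<in>block \<eta> k. \<forall>j\<in>block \<eta> l. M $ i $ j = 0))}"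

text \<open>The vector whose component in each block is the first canonical basis vector.\<close>

definition u0 :: "nat list \<Rightarrow> complex ^ ('n::{finite,linorder})" where
  "u0 \<eta> = (\<chi> i. if \<exists>k<length \<eta>. pos i = block_start \<eta> k then 1 else 0)"

end

theory Submission
  imports Defs
begin

text \<open>
  If \<open>G(v)\<close> is dense, it meets every neighbourhood of \<open>v\<^sub>0\<close>. A word \<open>M\<close> with \<open>M v\<close> close enough to \<open>v\<^sub>0\<close>
  has nonzero diagonal entries in block form, because the first coordinate of a block is only multiplied
  by the diagonal entry; so \<open>M\<close> is invertible and \<open>G(M v) = M G(v)\<close> is dense too. Letting
  \<open>M v \<rightarrow> v\<^sub>0\<close> gives \<open>J\<^sub>G(v\<^sub>0) = \<complex>\<^sup>n\<close>.

  Conversely let \<open>J\<^sub>G(v\<^sub>0) = \<complex>\<^sup>n\<close>. Then \<open>v\<^sub>0\<close> is cyclic: otherwise some nonzero functional \<open>\<phi>\<close> kills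
  \<open>G(v\<^sub>0)\<close>, and by triangularity \<open>\<phi>\<close> can be taken to be a common eigenfunctional, whose eigenvalue is the
  diagonal entry of some block. Along \<open>g\<^sub>m x\<^sub>m \<rightarrow> y\<close> with \<open>x\<^sub>m \<rightarrow> v\<^sub>0\<close> that entry converges, hence
  \<open>\<phi> (g\<^sub>m x\<^sub>m) \<rightarrow> 0\<close> and \<open>\<phi> y = 0\<close> for all \<open>y\<close>. By cyclicity \<open>x\<^sub>m = B\<^sub>m v\<^sub>0\<close> with \<open>B\<^sub>m\<close> commuting with \<open>G\<close>
  and \<open>B\<^sub>m \<rightarrow> I\<close>, so \<open>g\<^sub>m x\<^sub>m = B\<^sub>m g\<^sub>m v\<^sub>0\<close> and therefore \<open>g\<^sub>m v\<^sub>0 \<rightarrow> y\<close>.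
\<close>

section \<open>Words in commuting generators\<close>

lemma word_cong: "(\<And>i. i < p \<Longrightarrow> k i = l i) \<Longrightarrow> word A p k = word A p l"
  by (induction p) auto

lemma matpow_commute: "M ** N = N ** M \<Longrightarrow> matpow M k ** N = N ** matpow M k"
proof (induction k)
  case (Suc k)
  have "matpow M (Suc k) ** N = M ** (matpow M k ** N)"
    by (simp add: matrix_mul_assoc)
  also have "\<dots> = (M ** N) ** matpow M k"
    using Suc by (simp add: matrix_mul_assoc)
  also have "\<dots> = N ** matpow M (Suc k)"
    using Suc.prems by (simp add: matrix_mul_assoc)
  finally show ?case .
qed simp

lemma matpow_add: "matpow M (k + l) = matpow M k ** matpow M l"
  by (induction k) (simp_all add: matrix_mul_assoc)

lemma word_commute:
  "(\<And>i. i < p \<Longrightarrow> A i ** N = N ** A i) \<Longrightarrow> word A p k ** N = N ** word A p k"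
proof (induction p)
  case (Suc p)
  have "word A (Suc p) k ** N = word A p k ** (matpow (A p) (k p) ** N)"
    by (simp add: matrix_mul_assoc)
  also have "\<dots> = (word A p k ** N) ** matpow (A p) (k p)"
    using matpow_commute[OF Suc.prems[of p]] by (simp add: matrix_mul_assoc)
  also have "\<dots> = N ** word A (Suc p) k"
    using Suc by (simp add: matrix_mul_assoc)
  finally show ?case .
qed simp

text \<open>Makes the generated set closed under products; symmetry in the two exponent functions
  then gives commutativity.\<close>

lemma word_add:
  assumes "\<forall>i<p. \<forall>j<p. A i ** A j = A j ** A i"
  shows "word A p (\<lambda>i. k i + l i) = word A p k ** word A p l"
  using assms
proof (induction p)
  case (Suc p)
  have "word A p l ** A p = A p ** word A p l"
    using Suc.prems by (intro word_commute) auto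
  then have swap: "matpow (A p) (k p) ** word A p l = word A p l ** matpow (A p) (k p)"
    by (intro matpow_commute) simp
  have "word A (Suc p) k ** word A (Suc p) l =
      word A p k ** (matpow (A p) (k p) ** word A p l) ** matpow (A p) (l p)"
    by (simp add: matrix_mul_assoc)
  also have "\<dots> = (word A p k ** word A p l) ** (matpow (A p) (k p) ** matpow (A p) (l p))"
    by (simp add: swap matrix_mul_assoc)
  also have "\<dots> = word A (Suc p) (\<lambda>i. k i + l i)"
    using Suc by (simp add: matpow_add)
  finally show ?case by simp
qed simp

lemma word_commute_word:
  assumes "\<forall>i<p. \<forall>j<p. A i ** A j = A j ** A i"
  shows "word A p k ** word A p l = word A p l ** word A p k"
  using word_add[OF assms, of k l] word_add[OF assms, of l k] by (simp add: add.commute)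

lemma word_zero: "word A p (\<lambda>_. 0) = mat 1"
  by (induction p) simp_all

section \<open>Short words are finite in number and do not affect density\<close>

lemma finite_bounded_words: "finite {word A p k |k. (\<Sum>i<p. k i) < m}"
proof -
  have "{word A p k |k. (\<Sum>i<p. k i) < m} \<subseteq> word A p ` PiE {..<p} (\<lambda>_. {..m})"
  proof
    fix M assume "M \<in> {word A p k |k. (\<Sum>i<p. k i) < m}"
    then obtain k where k: "M = word A p k" "(\<Sum>i<p. k i) < m" by blast
    \<comment> \<open>A word sees only the exponents below \<open>p\<close>, so cutting off the
      others leaves finitely many bounded exponent functions.\<close>
    have "k i \<le> m" if "i < p" for i
      using member_le_sum[of i "{..<p}" k] that k(2) by simp
    then have "restrict k {..<p} \<in> PiE {..<p} (\<lambda>_. {..m})" by auto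
    moreover have "M = word A p (restrict k {..<p})"
      unfolding k(1) by (rule word_cong) auto
    ultimately show "M \<in> word A p ` PiE {..<p} (\<lambda>_. {..m})" by blast
  qed
  then show ?thesis
    by (rule finite_subset) (auto intro!: finite_imageI finite_PiE)
qed

text \<open>The complement of \<open>closure D\<close> is open and contained in \<open>F\<close>; a
  finite open set is empty in a perfect space.\<close>

lemma closure_minus_finite:
  fixes D F :: "'a::{real_normed_vector,perfect_space} set"
  assumes "closure (D \<union> F) = UNIV" "finite F"
  shows "closure D = UNIV"
proof -
  have "UNIV = closure D \<union> F"
    using assms by (simp add: finite_imp_closed)
  then have "finite (- closure D)"
    using assms(2) by (auto intro: finite_subset[of _ F])
  then have "- closure D = {}"
    using finite_imp_not_open by (metis closed_closure open_Compl)
  then show ?thesis by auto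
qed

text \<open>Supplies the exponent sums tending to infinity that \<open>J_set\<close>
  requires.\<close>

lemma dense_orbit_long_words:
  assumes "closure (orbit (semigroup_gen A p) w) = UNIV"
  shows "closure {word A p k *v w |k. (\<Sum>i<p. k i) \<ge> m} = UNIV"
proof (rule closure_minus_finite)
  let ?F = "(\<lambda>M. M *v w) ` {word A p k |k. (\<Sum>i<p. k i) < m}"
  show "finite ?F"
    by (intro finite_imageI finite_bounded_words)
  have "orbit (semigroup_gen A p) w = {word A p k *v w |k. (\<Sum>i<p. k i) \<ge> m} \<union> ?F"
    unfolding orbit_def semigroup_gen_def using not_le by blast
  then show "closure ({word A p k *v w |k. (\<Sum>i<p. k i) \<ge> m} \<union> ?F) = UNIV"
    using assms by simp
qed

section \<open>Positions, blocks and triangular matrices\<close>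

lemma pos_strict_mono: "i < j \<Longrightarrow> pos i < pos (j::'n::{finite,linorder})"
  unfolding pos_def by (rule psubset_card_mono) auto

lemma pos_less_iff: "pos i < pos j \<longleftrightarrow> i < (j::'n::{finite,linorder})"
  by (metis pos_strict_mono less_asym linorder_neq_iff)

lemma pos_less_card: "pos (i::'n::{finite,linorder}) < CARD('n)"
  unfolding pos_def by (rule psubset_card_mono) auto

lemma pos_surj:
  assumes "m < CARD('n)"
  obtains i :: "'n::{finite,linorder}" where "pos i = m"
proof -
  have "inj (pos :: 'n \<Rightarrow> nat)"
    by (rule injI) (metis pos_less_iff linorder_neq_iff)
  then have "card (range (pos :: 'n \<Rightarrow> nat)) = card {..<CARD('n)}"
    by (simp add: card_image)
  then have "range (pos :: 'n \<Rightarrow> nat) = {..<CARD('n)}"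
    using pos_less_card by (intro card_subset_eq) auto
  then show ?thesis
    using assms that by (metis imageE lessThan_iff)
qed

lemma block_start_exhaust:
  assumes "m < sum_list \<eta>"
  shows "\<exists>k<length \<eta>. block_start \<eta> k \<le> m \<and> m < block_start \<eta> k + \<eta> ! k"
  using assms
proof (induction \<eta> arbitrary: m)
  case (Cons a \<eta>)
  show ?case
  proof (cases "m < a")
    case True
    then show ?thesis by (intro exI[of _ 0]) (simp add: block_start_def)
  next
    case False
    then have "m - a < sum_list \<eta>" using Cons.prems by auto
    from Cons.IH[OF this] obtain k
      where "k < length \<eta>" "block_start \<eta> k \<le> m - a" "m - a < block_start \<eta> k + \<eta> ! k"
      by blast
    then show ?thesis using False by (intro exI[of _ "Suc k"]) (auto simp: block_start_def)
  qed
qed simp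

context
  fixes \<eta> :: "nat list"
  assumes \<eta>: "sum_list \<eta> = CARD('n::{finite,linorder})" "\<forall>m\<in>set \<eta>. m > 0"
begin

lemma block_cover: "\<exists>k<length \<eta>. (i::'n::{finite,linorder}) \<in> block \<eta> k"
  using block_start_exhaust[of "pos i" \<eta>] pos_less_card[of i] \<eta> unfolding block_def by auto

lemma K_set_lower_triangular:
  fixes N :: "complex ^ ('n::{finite,linorder}) ^ ('n::{finite,linorder})"
  assumes "N \<in> K_set \<eta>" "i < j"
  shows "N $ i $ j = 0"
proof -
  obtain k l where "k < length \<eta>" "i \<in> block \<eta> k" "l < length \<eta>" "j \<in> block \<eta> l"
    using block_cover by meson
  then show ?thesis
    using assms unfolding K_set_def T_on_def by (cases "k = l") blast+
qed

text \<open>The index \<open>s\<close> is the first one of the block containing \<open>i\<close>. In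
  row \<open>s\<close>, entries to the right of the diagonal vanish by triangularity, and those to
  the left lie in other blocks.\<close>

lemma K_set_block_first:
  fixes i :: "'n::{finite,linorder}"
  obtains s :: "'n::{finite,linorder}" where "u0 \<eta> $ s = 1"
    "\<And>N. N \<in> K_set \<eta> \<Longrightarrow> N $ i $ i = N $ s $ s"
    "\<And>N x. N \<in> K_set \<eta> \<Longrightarrow> (N *v x) $ s = N $ s $ s * x $ s"
proof -
  obtain k where k: "k < length \<eta>" "i \<in> block \<eta> k"
    using block_cover by blast
  have "block_start \<eta> k < CARD('n::{finite,linorder})"
    using k(2) pos_less_card[of i] unfolding block_def by auto
  then obtain s :: "'n::{finite,linorder}" where s: "pos s = block_start \<eta> k"
    by (rule pos_surj)
  have sk: "s \<in> block \<eta> k"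
    using s \<eta>(2) k(1) by (simp add: block_def)
  show ?thesis
  proof
    show "u0 \<eta> $ s = 1"
      using s k(1) by (auto simp: u0_def)
    fix N :: "complex ^ ('n::{finite,linorder}) ^ ('n::{finite,linorder})" and x assume N: "N \<in> K_set \<eta>"
    have "T_on (block \<eta> k) N"
      using N k(1) by (simp add: K_set_def)
    then show "N $ i $ i = N $ s $ s"
      using k(2) sk unfolding T_on_def by blast
    have "N $ s $ j = 0" if "j \<noteq> s" for j
    proof (cases "s < j")
      case True
      then show ?thesis using K_set_lower_triangular N by blast
    next
      case False
      then have "pos j < block_start \<eta> k"
        using that s pos_less_iff[of j s] by auto
      then have "j \<notin> block \<eta> k" by (simp add: block_def)
      moreover obtain l where "l < length \<eta>" "j \<in> block \<eta> l"
        using block_cover by blast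
      ultimately show ?thesis
        using N k(1) sk unfolding K_set_def by blast
    qed
    then have "(\<Sum>j\<in>UNIV. N $ s $ j * x $ j) = (\<Sum>j\<in>{s}. N $ s $ j * x $ j)"
      by (intro sum.mono_neutral_right) auto
    then show "(N *v x) $ s = N $ s $ s * x $ s"
      by (simp add: matrix_vector_mult_def)
  qed
qed

end

text \<open>At the first nonzero coordinate of a kernel vector, the product reduces to a diagonal
  entry times that coordinate.\<close>

lemma lower_triangular_invertible:
  fixes N :: "complex ^ ('n::{finite,linorder}) ^ ('n::{finite,linorder})"
  assumes lower: "\<And>i j. i < j \<Longrightarrow> N $ i $ j = 0" and diag: "\<And>i. N $ i $ i \<noteq> 0"
  shows "invertible N"
proof -
  have "x = 0" if "N *v x = 0" for x
  proof (rule ccontr)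
    assume "x \<noteq> 0"
    define i where "i = Min {i. x $ i \<noteq> 0}"
    have ne: "{i. x $ i \<noteq> 0} \<noteq> {}"
      using \<open>x \<noteq> 0\<close> by (auto simp: vec_eq_iff)
    have xi: "x $ i \<noteq> 0"
      using Min_in[OF _ ne] unfolding i_def by auto
    have "x $ j = 0" if "j < i" for j
      using that Min_le[of "{i. x $ i \<noteq> 0}" j] unfolding i_def by (auto simp: not_less[symmetric])
    then have "N $ i $ j * x $ j = 0" if "j \<noteq> i" for j
      using that lower[of i j] by (cases j i rule: linorder_cases) auto
    then have "(\<Sum>j\<in>UNIV. N $ i $ j * x $ j) = (\<Sum>j\<in>{i}. N $ i $ j * x $ j)"
      by (intro sum.mono_neutral_right) auto
    then have "(N *v x) $ i = N $ i $ i * x $ i"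
      by (simp add: matrix_vector_mult_def)
    then show False using that diag xi by simp
  qed
  then show ?thesis
    by (simp add: invertible_left_inverse matrix_left_invertible_ker)
qed

section \<open>Annihilating functionals and common eigenfunctionals\<close>

text \<open>The bilinear pairing, without complex conjugation.\<close>

definition dot :: "complex ^ 'n \<Rightarrow> complex ^ 'n \<Rightarrow> complex" where
  "dot \<phi> x = (\<Sum>i\<in>UNIV. \<phi> $ i * x $ i)"

lemma dot_diff_left: "dot (\<phi> - \<psi>) x = dot \<phi> x - dot \<psi> x"
  by (simp add: dot_def left_diff_distrib sum_subtractf)

lemma dot_scale_left: "dot (c *s \<phi>) x = c * dot \<phi> x"
  by (simp add: dot_def sum_distrib_left mult.assoc)

lemma dot_axis: "dot \<phi> (axis i 1) = \<phi> $ i"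
  by (simp add: dot_def axis_def if_distrib cong: if_cong)

lemma dot_matrix: "dot \<phi> (N *v x) = dot (\<phi> v* N) x"
proof -
  have "dot \<phi> (N *v x) = (\<Sum>i\<in>UNIV. \<Sum>j\<in>UNIV. \<phi> $ i * (N $ i $ j * x $ j))"
    by (simp add: dot_def matrix_vector_mult_def sum_distrib_left)
  also have "\<dots> = (\<Sum>j\<in>UNIV. \<Sum>i\<in>UNIV. \<phi> $ i * (N $ i $ j * x $ j))"
    by (rule sum.swap)
  also have "\<dots> = dot (\<phi> v* N) x"
    by (simp add: dot_def vector_matrix_mult_def sum_distrib_right sum_distrib_left mult_ac)
  finally show ?thesis .
qed

lemma tendsto_dot: "(f \<longlongrightarrow> a) F \<Longrightarrow> ((\<lambda>x. dot \<phi> (f x)) \<longlongrightarrow> dot \<phi> a) F"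
  unfolding dot_def by (intro tendsto_intros)

text \<open>A complex subspace is also a real one, so some nonzero \<open>a\<close> is orthogonal to
  it for the real inner product. Conjugating the entries of \<open>a\<close> gives a complex
  functional with that inner product as real part.\<close>

lemma annihilating_functional:
  fixes W :: "(complex ^ 'n) set"
  assumes W: "vec.subspace W" and "W \<noteq> UNIV"
  obtains \<phi> where "\<phi> \<noteq> 0" "\<And>x. x \<in> W \<Longrightarrow> dot \<phi> x = 0"
proof -
  have scaleR: "c *\<^sub>R x = of_real c *s x" for c and x :: "complex ^ 'n"
    unfolding vec_eq_iff vector_scaleR_component by (simp add: scaleR_conv_of_real)
  have "subspace W"
    unfolding subspace_def scaleR using W by (auto simp: vec.subspace_def)
  then have "span W = W" by simp
  then obtain a where a: "a \<noteq> 0" "\<And>x. x \<in> W \<Longrightarrow> a \<bullet> x = 0"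
    using span_not_UNIV_orthogonal[of W] \<open>W \<noteq> UNIV\<close> by metis
  define \<phi> where "\<phi> = (\<chi> i. cnj (a $ i))"
  have re: "Re (dot \<phi> x) = a \<bullet> x" for x
    by (simp add: dot_def \<phi>_def inner_vec_def inner_complex_def)
  show ?thesis
  proof
    show "\<phi> \<noteq> 0"
      using a(1) by (auto simp: \<phi>_def vec_eq_iff)
    fix x assume x: "x \<in> W"
    \<comment> \<open>The imaginary part at \<open>x\<close> is, up to sign, the real part at
      \<open>\<i> *s x\<close>, which vanishes too.\<close>
    have "dot \<phi> (\<i> *s x) = \<i> * dot \<phi> x"
      by (simp add: dot_def sum_distrib_left mult_ac)
    moreover have "\<i> *s x \<in> W"
      using W x by (auto simp: vec.subspace_def)
    ultimately have "Im (dot \<phi> x) = 0"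
      using re[of "\<i> *s x"] a(2) by simp
    then show "dot \<phi> x = 0"
      using re[of x] a(2)[OF x] by (simp add: complex_eq_iff)
  qed
qed

lemma triangular_eigenfunctional:
  fixes H :: "(complex ^ ('n::{finite,linorder}) ^ ('n::{finite,linorder})) set"
  assumes lower: "\<And>N i j. N \<in> H \<Longrightarrow> i < j \<Longrightarrow> N $ i $ j = 0"
    and mult: "\<And>M N. M \<in> H \<Longrightarrow> N \<in> H \<Longrightarrow> M ** N \<in> H"
    and \<psi>: "\<psi> \<noteq> 0" "\<And>N. N \<in> H \<Longrightarrow> dot \<psi> (N *v u) = 0"
  obtains \<phi> i where "\<phi> \<noteq> 0" "\<And>N. N \<in> H \<Longrightarrow> dot \<phi> (N *v u) = 0"
    "\<And>N. N \<in> H \<Longrightarrow> \<phi> v* N = N $ i $ i *s \<phi>"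
proof -
  \<comment> \<open>For \<open>\<phi>\<close> with the least possible last nonzero index \<open>i\<close>, \<open>\<phi> v* N - N\<^sub>i\<^sub>i \<phi>\<close> has a smaller one, so it vanishes.\<close>
  define S where "S = {\<phi>. \<phi> \<noteq> 0 \<and> (\<forall>N\<in>H. dot \<phi> (N *v u) = 0)}"
  define top_index where "top_index \<phi> = Max {i. \<phi> $ i \<noteq> 0}" for \<phi> :: "complex ^ ('n::{finite,linorder})"
  have "S \<noteq> {}" using \<psi> by (auto simp: S_def)
  then have "Min (top_index ` S) \<in> top_index ` S" by (intro Min_in) auto
  then obtain \<phi> where \<phi>: "\<phi> \<in> S" "top_index \<phi> = Min (top_index ` S)" by force
  define i where "i = top_index \<phi>"
  have least: "i \<le> top_index \<xi>" if "\<xi> \<in> S" for \<xi>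
    using that \<phi>(2) by (simp add: i_def)
  have zero: "\<phi> $ j = 0" if "i < j" for j
  proof (rule ccontr)
    assume "\<phi> $ j \<noteq> 0"
    then have "j \<le> i" unfolding i_def top_index_def by (intro Max_ge) auto
    then show False using that by simp
  qed
  have "\<phi> v* N = N $ i $ i *s \<phi>" if N: "N \<in> H" for N
  proof (rule ccontr)
    assume ne: "\<phi> v* N \<noteq> N $ i $ i *s \<phi>"
    define \<xi> where "\<xi> = \<phi> v* N - N $ i $ i *s \<phi>"
    \<comment> \<open>Closure of \<open>H\<close> under products lets \<open>N\<close> act on
      annihilating functionals.\<close>
    have "dot \<xi> (M *v u) = 0" if "M \<in> H" for M
    proof -
      have "dot (\<phi> v* N) (M *v u) = dot \<phi> ((N ** M) *v u)"
        by (simp add: dot_matrix[symmetric] matrix_vector_mul_assoc)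
      then show ?thesis
        using \<phi>(1) that mult[OF N that]
        by (simp add: \<xi>_def dot_diff_left dot_scale_left S_def)
    qed
    then have "\<xi> \<in> S" using ne by (auto simp: S_def \<xi>_def)
    have "\<xi> $ j = 0" if "i \<le> j" for j
    proof -
      \<comment> \<open>For \<open>l < j\<close> triangularity kills the term; for
        \<open>l > j\<close> the index lies beyond the last nonzero entry of
        \<open>\<phi>\<close>.\<close>
      have "N $ l $ j * \<phi> $ l = 0" if "l \<noteq> j" for l
        using that \<open>i \<le> j\<close> lower[OF N, of l j] zero[of l] by (cases l j rule: linorder_cases) auto
      then have "(\<Sum>l\<in>UNIV. N $ l $ j * \<phi> $ l) = (\<Sum>l\<in>{j}. N $ l $ j * \<phi> $ l)"
        by (intro sum.mono_neutral_right) auto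
      then have "(\<phi> v* N) $ j = N $ j $ j * \<phi> $ j"
        by (simp add: vector_matrix_mult_def mult.commute)
      then show ?thesis
        using zero[of j] that by (cases "i = j") (auto simp: \<xi>_def)
    qed
    moreover have "top_index \<xi> \<in> {i. \<xi> $ i \<noteq> 0}"
      unfolding top_index_def using \<open>\<xi> \<in> S\<close> by (intro Max_in) (auto simp: S_def vec_eq_iff)
    ultimately show False
      using least[OF \<open>\<xi> \<in> S\<close>] by auto
  qed
  then show ?thesis
    using that \<phi>(1) by (auto simp: S_def)
qed


section \<open>Cyclic vectors and the commutant\<close>

lemma mat_mult_vec: "mat c *v x = c *s x"
  by (simp add: vec_eq_iff matrix_vector_mult_def mat_def if_distrib if_distribR cong: if_cong)

lemma mat_commute: "mat c ** M = M ** mat (c::complex)"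
  by (simp add: vec_eq_iff matrix_matrix_mult_def mat_def if_distrib if_distribR mult.commute cong: if_cong)

lemma matrix_add_rdistrib: "(A + B) ** C = A ** C + (B ** C :: complex ^ 'n ^ 'n)"
  by (simp add: vec_eq_iff matrix_matrix_mult_def distrib_right sum.distrib)

lemma norm_vector_smult: "norm (c *s x) = cmod c * norm (x :: complex ^ 'n)"
  by (simp add: norm_vec_def norm_mult L2_set_right_distrib)

text \<open>The error is relative to \<open>w\<close>, whose boundedness is not given. Once the
  factor \<open>c * norm (d m)\<close> is below 1/2, \<open>norm (w m)\<close> is at most twice
  \<open>norm (z m)\<close>, and \<open>z\<close> converges.\<close>

lemma tendsto_of_small_perturbation:
  fixes w z d :: "nat \<Rightarrow> 'a::real_normed_vector"
  assumes bound: "\<And>m. norm (z m - w m) \<le> c * norm (d m) * norm (w m)"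
    and c: "c \<ge> 0" and d: "d \<longlonglongrightarrow> 0" and z: "z \<longlonglongrightarrow> y"
  shows "w \<longlonglongrightarrow> y"
proof -
  have cd: "(\<lambda>m. c * norm (d m)) \<longlonglongrightarrow> 0"
    using tendsto_mult_right_zero[OF tendsto_norm_zero[OF d]] by simp
  have lim: "(\<lambda>m. c * norm (d m) * (2 * norm (z m))) \<longlonglongrightarrow> 0 * (2 * norm y)"
    by (intro tendsto_mult tendsto_const cd tendsto_norm z)
  have "\<forall>\<^sub>F m in sequentially. c * norm (d m) < 1 / 2"
    using order_tendstoD(2)[OF cd, of "1/2"] by simp
  then have "\<forall>\<^sub>F m in sequentially. norm (z m - w m) \<le> c * norm (d m) * (2 * norm (z m))"
  proof eventually_elim
    case (elim m)
    have "norm (w m) \<le> norm (z m) + norm (z m - w m)"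
      by (metis norm_minus_commute norm_triangle_sub)
    also have "\<dots> \<le> norm (z m) + 1 / 2 * norm (w m)"
      using bound[of m] mult_right_mono[OF less_imp_le[OF elim], of "norm (w m)"] by simp
    finally have "norm (w m) \<le> 2 * norm (z m)" by simp
    then have "c * norm (d m) * norm (w m) \<le> c * norm (d m) * (2 * norm (z m))"
      using c by (intro mult_left_mono) auto
    then show ?case using bound[of m] by (rule order_trans[rotated])
  qed
  then have "(\<lambda>m. z m - w m) \<longlonglongrightarrow> 0"
    by (rule Lim_null_comparison) (use lim in simp)
  from tendsto_diff[OF z this] show ?thesis by simp
qed

lemma cyclic_J_set_subset:
  fixes A :: "nat \<Rightarrow> complex ^ 'n ^ 'n"
  assumes comm: "\<forall>i<p. \<forall>j<p. A i ** A j = A j ** A i"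
    and cyclic: "vec.span (orbit (semigroup_gen A p) v) = UNIV"
  shows "J_set A p v \<subseteq> closure (orbit (semigroup_gen A p) v)"
proof
  fix y assume "y \<in> J_set A p v"
  then obtain X k where X: "X \<longlonglongrightarrow> v" and y: "(\<lambda>m. word A p (k m) *v X m) \<longlonglongrightarrow> y"
    by (auto simp: J_set_def)
  \<comment> \<open>The commutant of all words. Its values at \<open>v\<close> form a subspace
    containing the orbit, hence the whole space by cyclicity.\<close>
  define C where "C = {M. \<forall>l. M ** word A p l = word A p l ** M}"
  have "vec.subspace {M *v v |M. M \<in> C}"
    unfolding vec.subspace_def
  proof (intro conjI ballI allI)
    show "0 \<in> {M *v v |M. M \<in> C}"
      unfolding C_def
      by (rule CollectI, rule exI[of _ 0]) (simp add: vec_eq_iff matrix_matrix_mult_def)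
    fix x x' assume "x \<in> {M *v v |M. M \<in> C}" "x' \<in> {M *v v |M. M \<in> C}"
    then obtain M M' where "x = M *v v" "x' = M' *v v" "M \<in> C" "M' \<in> C" by blast
    then show "x + x' \<in> {M *v v |M. M \<in> C}"
      unfolding C_def
      by (intro CollectI exI[of _ "M + M'"])
        (simp add: matrix_vector_mult_add_rdistrib matrix_add_ldistrib matrix_add_rdistrib)
  next
    fix c x assume "x \<in> {M *v v |M. M \<in> C}"
    then obtain M where "x = M *v v" "M \<in> C" by blast
    then show "c *s x \<in> {M *v v |M. M \<in> C}"
      unfolding C_def
      by (intro CollectI exI[of _ "mat c ** M"])
        (auto simp: mat_mult_vec matrix_vector_mul_assoc[symmetric],
          metis mat_commute matrix_mul_assoc)
  qed
  moreover have "orbit (semigroup_gen A p) v \<subseteq> {M *v v |M. M \<in> C}"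
    using word_commute_word[OF comm] by (auto simp: orbit_def semigroup_gen_def C_def)
  ultimately have "{M *v v |M. M \<in> C} = UNIV"
    using cyclic vec.span_minimal by blast
  \<comment> \<open>One operator is fixed per basis vector, so that the operator sending
    \<open>v\<close> to \<open>x\<close> can be chosen linearly in \<open>x\<close>.\<close>
  then have "\<forall>i. \<exists>M. M \<in> C \<and> M *v v = axis i 1" by (auto simp: set_eq_iff) metis
  then obtain B where B: "\<And>i. B i \<in> C" "\<And>i. B i *v v = axis i 1" by metis
  \<comment> \<open>\<open>L x\<close> is the operator commuting with \<open>G\<close> that maps \<open>v\<close> to \<open>x\<close>, so \<open>B\<^sub>m\<close> of the header is \<open>I + L (x\<^sub>m - v)\<close>.\<close>
  define L where "L x w = (\<Sum>i\<in>UNIV. x $ i *s (B i *v w))" for x w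
  have Lv: "L x v = x" for x
    by (simp add: L_def B(2) basis_expansion)
  have Lcomm: "word A p l *v L x w = L x (word A p l *v w)" for l x w
  proof -
    have "word A p l *v L x w = (\<Sum>i\<in>UNIV. x $ i *s (word A p l *v (B i *v w)))"
      unfolding L_def by (simp add: vec.linear_sum[OF matrix_vector_mul_linear_gen] vector_scalar_commute)
    also have "\<dots> = L x (word A p l *v w)"
      using B(1) by (simp add: L_def C_def matrix_vector_mul_assoc)
    finally show ?thesis .
  qed
  define c where "c = (\<Sum>i\<in>UNIV. onorm ((*v) (B i)))"
  have Lbound: "norm (L x w) \<le> c * norm x * norm w" for x w
  proof -
    have "norm (L x w) \<le> (\<Sum>i\<in>UNIV. norm (x $ i *s (B i *v w)))"
      unfolding L_def by (rule norm_sum)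
    also have "\<dots> \<le> (\<Sum>i\<in>UNIV. norm x * (onorm ((*v) (B i)) * norm w))"
      unfolding norm_vector_smult
      by (intro sum_mono mult_mono onorm Finite_Cartesian_Product.norm_nth_le) auto
    finally show ?thesis
      by (simp add: c_def sum_distrib_left sum_distrib_right mult_ac)
  qed
  have "(\<lambda>m. word A p (k m) *v v) \<longlonglongrightarrow> y"
  proof (rule tendsto_of_small_perturbation[OF _ _ _ y])
    show "c \<ge> 0"
      unfolding c_def by (intro sum_nonneg onorm_pos_le) simp
    show "(\<lambda>m. X m - v) \<longlonglongrightarrow> 0"
      using X by (simp add: LIM_zero)
    fix m
    \<comment> \<open>Moving \<open>L\<close> past the word turns the difference into
      \<open>L (X m - v)\<close> applied to the orbit point, a relative error.\<close>
    have "word A p (k m) *v X m - word A p (k m) *v v = word A p (k m) *v L (X m - v) v"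
      by (simp add: Lv matrix_vector_mult_diff_distrib)
    then show "norm (word A p (k m) *v X m - word A p (k m) *v v)
        \<le> c * norm (X m - v) * norm (word A p (k m) *v v)"
      by (simp add: Lcomm Lbound)
  qed
  moreover have "word A p (k m) *v v \<in> orbit (semigroup_gen A p) v" for m
    by (auto simp: orbit_def semigroup_gen_def)
  ultimately show "y \<in> closure (orbit (semigroup_gen A p) v)"
    unfolding closure_sequential by (intro exI[of _ "\<lambda>m. word A p (k m) *v v"]) blast
qed

section \<open>Implications for a semigroup conjugated into block form\<close>

lemma LIMSEQ_dist_inverse_Suc:
  assumes "\<And>m. dist (f m) l < inverse (real (Suc m))"
  shows "f \<longlonglongrightarrow> l"
proof -
  have "(\<lambda>m. dist (f m) l) \<longlonglongrightarrow> 0"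
    by (rule tendsto_sandwich[OF _ _ tendsto_const LIMSEQ_inverse_real_of_nat])
      (auto intro!: always_eventually less_imp_le assms simp del: of_nat_Suc)
  then show ?thesis by (rule tendsto_dist_iff[THEN iffD2])
qed

context
  fixes A :: "nat \<Rightarrow> complex ^ ('n::{finite,linorder}) ^ ('n::{finite,linorder})"
    and P Q :: "complex ^ ('n::{finite,linorder}) ^ ('n::{finite,linorder})"
    and p :: nat and \<eta> :: "nat list"
  assumes comm: "\<forall>i<p. \<forall>j<p. A i ** A j = A j ** A i"
    and PQ: "P ** Q = mat 1" "Q ** P = mat 1"
    and \<eta>: "sum_list \<eta> = CARD('n::{finite,linorder})" "\<forall>m\<in>set \<eta>. m > 0"
    and K: "\<And>k. Q ** word A p k ** P \<in> K_set \<eta>"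
begin

lemma inverse_vec: "P *v (Q *v x) = x" "Q *v (P *v x) = x"
  by (simp_all add: matrix_vector_mul_assoc PQ)

lemma conjugate_vec: "(Q ** M ** P) *v x = Q *v (M *v (P *v x))"
  by (simp add: matrix_vector_mul_assoc matrix_mul_assoc)

lemma J_set_imp_cyclic:
  assumes J: "J_set A p (P *v u0 \<eta>) = UNIV"
  shows "vec.span (orbit (semigroup_gen A p) (P *v u0 \<eta>)) = UNIV"
proof (rule ccontr)
  assume "\<not> ?thesis"
  then obtain \<psi> where \<psi>: "\<psi> \<noteq> 0"
    "\<And>x. x \<in> vec.span (orbit (semigroup_gen A p) (P *v u0 \<eta>)) \<Longrightarrow> dot \<psi> x = 0"
    using annihilating_functional[OF vec.subspace_span] by metis
  define H where "H = range (\<lambda>k. Q ** word A p k ** P)"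
  \<comment> \<open>In block coordinates the functional becomes \<open>\<psi> v* P\<close>.\<close>
  have ne: "\<psi> v* P \<noteq> 0"
    using \<psi>(1) by (metis PQ(1) vector_matrix_mul_assoc vector_matrix_mul_rid vector_matrix_mult_0)
  have zero: "dot (\<psi> v* P) (N *v u0 \<eta>) = 0" if NH: "N \<in> H" for N
  proof -
    obtain k where "N = Q ** word A p k ** P" using NH by (auto simp: H_def)
    moreover have "word A p k *v (P *v u0 \<eta>) \<in> orbit (semigroup_gen A p) (P *v u0 \<eta>)"
      by (auto simp: orbit_def semigroup_gen_def)
    ultimately show ?thesis
      by (simp add: dot_matrix[symmetric] conjugate_vec inverse_vec \<psi>(2) vec.span_base)
  qed
  have mult: "M ** N \<in> H" if MN: "M \<in> H" "N \<in> H" for M N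
  proof -
    obtain k l where "M = Q ** word A p k ** P" "N = Q ** word A p l ** P"
      using MN by (auto simp: H_def)
    then have "M ** N = Q ** word A p k ** (P ** Q) ** word A p l ** P"
      by (simp add: matrix_mul_assoc)
    also have "\<dots> = Q ** word A p (\<lambda>i. k i + l i) ** P"
      by (simp add: PQ word_add[OF comm] matrix_mul_assoc)
    finally show ?thesis by (auto simp: H_def)
  qed
  have lower: "N $ i $ j = 0" if "N \<in> H" "i < j" for N i j
    using K_set_lower_triangular[OF \<eta>] K that by (auto simp: H_def)
  obtain \<phi> i where \<phi>: "\<phi> \<noteq> 0" "\<And>N. N \<in> H \<Longrightarrow> dot \<phi> (N *v u0 \<eta>) = 0"
      "\<And>N. N \<in> H \<Longrightarrow> \<phi> v* N = N $ i $ i *s \<phi>"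
    using triangular_eigenfunctional[OF lower mult ne zero] by blast
  obtain s where s: "u0 \<eta> $ s = 1"
    "\<And>N. N \<in> K_set \<eta> \<Longrightarrow> N $ i $ i = N $ s $ s"
    "\<And>N x. N \<in> K_set \<eta> \<Longrightarrow> (N *v x) $ s = N $ s $ s * x $ s"
    using K_set_block_first[OF \<eta>] by metis
  have "mat 1 \<in> H"
    unfolding H_def by (rule range_eqI[of _ _ "\<lambda>_. 0"]) (simp add: word_zero PQ)
  then have \<phi>u: "dot \<phi> (u0 \<eta>) = 0" using \<phi>(2) by force
  have "dot \<phi> y = 0" for y
  proof -
    \<comment> \<open>The target is \<open>P *v y\<close>, so that the limit in block coordinates is
      \<open>y\<close>.\<close>
    obtain X k where X: "X \<longlonglongrightarrow> P *v u0 \<eta>"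
      and lim: "(\<lambda>m. word A p (k m) *v X m) \<longlonglongrightarrow> P *v y"
      using J unfolding J_set_def by (auto simp: set_eq_iff) metis
    define N where "N m = Q ** word A p (k m) ** P" for m
    have N: "N m \<in> H" "N m \<in> K_set \<eta>" for m
      using K by (auto simp: N_def H_def)
    define Z where "Z m = Q *v X m" for m
    have cont: "(\<lambda>m. Q *v f m) \<longlonglongrightarrow> Q *v l" if "f \<longlonglongrightarrow> l" for f l
      using that by (rule isCont_tendsto_compose[OF matrix_vector_mult_linear_continuous_at])
    have Z: "Z \<longlonglongrightarrow> u0 \<eta>"
      using cont[OF X] by (simp add: Z_def[abs_def] inverse_vec)
    have NZ: "(\<lambda>m. N m *v Z m) \<longlonglongrightarrow> y"
      using cont[OF lim] by (simp add: N_def Z_def conjugate_vec inverse_vec)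
    have Zs: "(\<lambda>m. Z m $ s) \<longlonglongrightarrow> 1"
      using tendsto_vec_nth[OF Z, of s] s(1) by simp
    have "(\<lambda>m. N m $ s $ s * Z m $ s) \<longlonglongrightarrow> y $ s"
      using tendsto_vec_nth[OF NZ, of s] s(3)[OF N(2)] by simp
    \<comment> \<open>Dividing by a coordinate that tends to 1 shows that the diagonal entry itself
      converges. As the eigenvalue of \<open>\<phi>\<close>, it is then multiplied by
      \<open>dot \<phi> (Z m)\<close>, which tends to 0.\<close>
    then have "(\<lambda>m. N m $ s $ s * Z m $ s / Z m $ s) \<longlonglongrightarrow> y $ s / 1"
      by (intro tendsto_divide Zs) auto
    moreover have "\<forall>\<^sub>F m in sequentially. N m $ s $ s * Z m $ s / Z m $ s = N m $ s $ s"
      using tendsto_imp_eventually_ne[OF Zs, of 0] by (auto elim: eventually_mono)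
    ultimately have "(\<lambda>m. N m $ s $ s) \<longlonglongrightarrow> y $ s / 1"
      by (rule Lim_transform_eventually)
    then have "(\<lambda>m. N m $ s $ s * dot \<phi> (Z m)) \<longlonglongrightarrow> y $ s / 1 * dot \<phi> (u0 \<eta>)"
      by (intro tendsto_mult tendsto_dot Z)
    moreover have "N m $ s $ s * dot \<phi> (Z m) = dot \<phi> (N m *v Z m)" for m
      using \<phi>(3)[OF N(1)] s(2)[OF N(2)] by (simp add: dot_matrix dot_scale_left)
    ultimately have "(\<lambda>m. dot \<phi> (N m *v Z m)) \<longlonglongrightarrow> 0"
      by (simp add: \<phi>u)
    then show ?thesis
      using tendsto_dot[OF NZ] LIMSEQ_unique by blast
  qed
  then show False
    using \<phi>(1) dot_axis[of \<phi>] by (simp add: vec_eq_iff)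
qed

lemma dense_orbit_imp_J_set:
  assumes v: "closure (orbit (semigroup_gen A p) v) = UNIV"
  shows "J_set A p (P *v u0 \<eta>) = UNIV"
proof -
  \<comment> \<open>An open neighbourhood of the target vector: in block coordinates, the first
    entry of every block is nonzero.\<close>
  define U where "U = {x. \<forall>s\<in>{s. u0 \<eta> $ s = 1}. (Q *v x) $ s \<noteq> 0}"
  have "U = (\<Inter>s\<in>{s. u0 \<eta> $ s = 1}. {x. (Q *v x) $ s \<noteq> 0})"
    by (auto simp: U_def)
  then have "open U"
    by (auto intro!: open_INT open_Collect_neq continuous_intros)
  have u0U: "P *v u0 \<eta> \<in> U"
    by (simp add: U_def inverse_vec)
  have dense: "closure (orbit (semigroup_gen A p) (word A p l *v v)) = UNIV"
    if l: "word A p l *v v \<in> U" for l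
  proof -
    let ?N = "Q ** word A p l ** P"
    have "?N $ i $ i \<noteq> 0" for i
    proof -
      obtain s where s: "u0 \<eta> $ s = 1" "?N $ i $ i = ?N $ s $ s"
        "\<And>x. (?N *v x) $ s = ?N $ s $ s * x $ s"
        using K_set_block_first[OF \<eta>] K by metis
      \<comment> \<open>This entry is the diagonal entry times coordinate \<open>s\<close> of
        \<open>Q *v v\<close>, so both factors are nonzero.\<close>
      have "(Q *v (word A p l *v v)) $ s \<noteq> 0"
        using l s(1) by (simp add: U_def)
      then show ?thesis
        using s(2) s(3)[of "Q *v v"] by (auto simp: conjugate_vec inverse_vec)
    qed
    then have "invertible ?N"
      using K_set_lower_triangular[OF \<eta> K] by (intro lower_triangular_invertible) auto
    then obtain R where "?N ** R = mat 1" by (auto simp: invertible_def)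
    \<comment> \<open>A right inverse of the block form conjugates back to a right inverse of the
      word.\<close>
    then have "word A p l *v (P *v (R *v (Q *v x))) = x" for x
      by (metis conjugate_vec inverse_vec matrix_vector_mul_assoc matrix_vector_mul_lid)
    then have surj: "surj ((*v) (word A p l))" by (rule surjI)
    have "word A p k *v (word A p l *v v) = word A p l *v (word A p k *v v)" for k
      using word_commute_word[OF comm, of k l] by (simp add: matrix_vector_mul_assoc)
    \<comment> \<open>By commutativity the new orbit is the image of a dense set under a continuous
      surjection.\<close>
    then have "orbit (semigroup_gen A p) (word A p l *v v)
        = (*v) (word A p l) ` orbit (semigroup_gen A p) v"
      by (auto simp: orbit_def semigroup_gen_def image_iff) metis
    moreover have "(*v) (word A p l) ` closure (orbit (semigroup_gen A p) v)
        \<subseteq> closure ((*v) (word A p l) ` orbit (semigroup_gen A p) v)"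
      by (intro image_closure_subset matrix_vector_mult_linear_continuous_on closed_closure closure_subset)
    ultimately show ?thesis using v surj by auto
  qed
  have "y \<in> J_set A p (P *v u0 \<eta>)" for y
  proof -
    define R where "R m x k \<longleftrightarrow> dist x (P *v u0 \<eta>) < inverse (real (Suc m)) \<and>
      m \<le> (\<Sum>i<p. k i) \<and> dist (word A p k *v x) y < inverse (real (Suc m))" for m x k
    have "\<exists>x k. R m x k" for m
    proof -
      let ?e = "inverse (real (Suc m))"
      have "open (U \<inter> ball (P *v u0 \<eta>) ?e)" "P *v u0 \<eta> \<in> U \<inter> ball (P *v u0 \<eta>) ?e"
        using \<open>open U\<close> u0U by auto
      then have "(U \<inter> ball (P *v u0 \<eta>) ?e) \<inter> orbit (semigroup_gen A p) v \<noteq> {}"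
        using v by (metis IntI UNIV_I empty_iff open_Int_closure_eq_empty)
      then obtain l where l: "word A p l *v v \<in> U" "dist (word A p l *v v) (P *v u0 \<eta>) < ?e"
        by (auto simp: orbit_def semigroup_gen_def dist_commute)
      \<comment> \<open>The word \<open>l\<close> brings the base point near
        \<open>P *v u0 \<eta>\<close>; a second word, of exponent sum at least \<open>m\<close>,
        then brings it near \<open>y\<close>.\<close>
      have "y \<in> closure {word A p k *v (word A p l *v v) |k. (\<Sum>i<p. k i) \<ge> m}"
        using dense_orbit_long_words[OF dense[OF l(1)]] by simp
      moreover have "?e > 0" by simp
      ultimately obtain z where z: "z \<in> {word A p k *v (word A p l *v v) |k. (\<Sum>i<p. k i) \<ge> m}"
        "dist y z < ?e"
        using closure_approachableD by meson
      from z(1) obtain k where k: "z = word A p k *v (word A p l *v v)" "m \<le> (\<Sum>i<p. k i)"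
        by (elim CollectE exE conjE)
      show ?thesis
        using l(2) k(2) z(2)[unfolded k(1)] unfolding R_def by (intro exI conjI) (simp_all add: dist_commute)
    qed
    then obtain X k where R: "\<And>m. R m (X m) (k m)"
      by metis
    have Xk: "dist (X m) (P *v u0 \<eta>) < inverse (real (Suc m))"
      "m \<le> (\<Sum>i<p. k m i)" "dist (word A p (k m) *v X m) y < inverse (real (Suc m))" for m
      using R[of m] unfolding R_def by blast+
    have "X \<longlonglongrightarrow> P *v u0 \<eta>" "(\<lambda>m. word A p (k m) *v X m) \<longlonglongrightarrow> y"
      by (rule LIMSEQ_dist_inverse_Suc[OF Xk(1)], rule LIMSEQ_dist_inverse_Suc[OF Xk(3)])
    moreover have "filterlim (\<lambda>m. \<Sum>j<p. k m j) at_top sequentially"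
      using Xk(2) by (intro filterlim_at_top_mono[OF filterlim_ident]) auto
    ultimately show ?thesis unfolding J_set_def by blast
  qed
  then show ?thesis by blast
qed

end

theorem corollary1p3:
  fixes A :: "nat \<Rightarrow> complex ^ ('n::{finite,linorder}) ^ ('n::{finite,linorder})"
    and P :: "complex ^ ('n::{finite,linorder}) ^ ('n::{finite,linorder})"
    and p r :: nat
    and \<eta> :: "nat list"
    and G :: "(complex ^ ('n::{finite,linorder}) ^ ('n::{finite,linorder})) set"
    and v0 :: "complex ^ ('n::{finite,linorder})"
  assumes "p \<ge> 1"
    and "\<forall>i<p. \<forall>j<p. A i ** A j = A j ** A i"
    and "G = semigroup_gen A p"
    and "invertible P"
    and "r \<in> {1..CARD('n)}"
    and "length \<eta> = r"
    and "\<forall>m\<in>set \<eta>. m > 0"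
    and "sum_list \<eta> = CARD('n)"
    and "{matrix_inv P ** M ** P |M. M \<in> G} \<subseteq> K_set \<eta>"
    and "v0 = P *v u0 \<eta>"
  shows "(hypercyclic G \<longleftrightarrow> J_set A p v0 = UNIV) \<and>
         (J_set A p v0 = UNIV \<longleftrightarrow> closure (orbit G v0) = UNIV)"
proof -
  have PQ: "P ** matrix_inv P = mat 1" "matrix_inv P ** P = mat 1"
    using someI_ex[OF assms(4)[unfolded invertible_def]] by (simp_all add: matrix_inv_def)
  have K: "matrix_inv P ** word A p k ** P \<in> K_set \<eta>" for k
    using assms(3,9) by (auto simp: semigroup_gen_def)
  \<comment> \<open>The three implications proved from here on close a cycle.\<close>
  have "closure (orbit G v0) = UNIV" if "J_set A p v0 = UNIV"
    using cyclic_J_set_subset[OF assms(2)] J_set_imp_cyclic[OF assms(2) PQ assms(8,7) K]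
      that assms(3,10) by auto
  moreover have "J_set A p v0 = UNIV" if "hypercyclic G"
    using dense_orbit_imp_J_set[OF assms(2) PQ assms(8,7) K] that assms(3,10)
    by (auto simp: hypercyclic_def)
  moreover have "hypercyclic G" if "closure (orbit G v0) = UNIV"
    using that by (auto simp: hypercyclic_def)
  ultimately show ?thesis by blast
qed

end
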